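(* Let $d\in\mathbb{R}$, let $\alpha(z)=1-\sum_{i=1}^p\alpha_i z^i$ and $\beta(z)=1-\sum_{j=1}^q\beta_j z^j$ be polynomials of orders $p$ and $q$ with no common roots and with $\beta(z)\neq 0$ for $|z|\le 1$, and let $$\lambda(z)=\frac{\alpha(z)}{\beta(z)}(1-z)^{-d}:=\sum_{k=0}^\infty \lambda_{d,k}z^k,\qquad \text{for all } |z|<1.$$ Then the coefficients $\lambda_{d,k}$, $k\in\mathbb{N}$, satisfy $$\lambda_{d,k}\sim \frac{1}{\Gamma(d)\,k^{1-d}}\,\frac{\alpha(1)}{\beta(1)},\qquad\text{as }k\to\infty.$$ Consequently, $\lambda_{d,k}=O(k^{d-1})$, as $k$ goes to infinity.
   Context: $\Gamma(\cdot)$ is the gamma function. $(1-z)^{-d}$ is defined by its Maclaurin series expansion. The notation $f(k)\sim g(k)$ as $k\to\infty$ means $f(k)/g(k)\to 1$ as $k\to\infty$; $f(k)=O(g(k))$ as $k\to\infty$ means $|f(k)|\le c|g(k)|$ for some $c>0$, as $k\to\infty$.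
   Formalization: The asymptotic equivalence is stated only for d not in {0,-1,-2,...} and α(1) ≠ 0, since otherwise its right-hand side is zero or undefined and the quotient has no meaning; the O(k^{d-1}) bound is stated for all real d and all α. *)

theory Defs
  imports "HOL-Analysis.Analysis" "HOL-Library.Landau_Symbols"
    "HOL-Computational_Algebra.Polynomial"
begin

definition arma_poly :: "nat \<Rightarrow> (nat \<Rightarrow> 'a::comm_ring_1) \<Rightarrow> 'a poly" where
  "arma_poly p a = 1 - (\<Sum>i=1..p. monom (a i) i)"

text \<open>
  The Maclaurin series of \<open>(1 - z)\<^sup>-\<^sup>d\<close>, i.e. the binomial series
  with exponent \<open>- d\<close> at \<open>- z\<close>. Only its values for \<open>cmod z < 1\<close> are meaningful.
\<close>

definition frac_int_series :: "real \<Rightarrow> complex \<Rightarrow> complex" where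
  "frac_int_series d z = (\<Sum>k. (of_real (- d) gchoose k) * (- z) ^ k)"

end

theory Submission
  imports Defs "HOL-Complex_Analysis.Complex_Analysis" "HOL-Real_Asymp.Real_Asymp"
begin

text \<open>
  The rational factor \<open>\<alpha>/\<beta>\<close> is holomorphic on a disc of radius larger than one, so its
  coefficients \<open>g\<^sub>i\<close> decay geometrically. The coefficients \<open>c\<^sub>k\<close> of \<open>(1 - z)\<^sup>-\<^sup>d\<close>
  satisfy \<open>c\<^sub>k k\<^sup>1\<^sup>-\<^sup>d \<rightarrow> 1/\<Gamma>(d)\<close> for every real \<open>d\<close>, with limit \<open>0\<close> at the poles of \<open>\<Gamma>\<close>.
  Since \<open>\<lambda>\<^sub>k\<close> is the convolution of \<open>g\<close> and \<open>c\<close>, dominated convergence gives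
  \<open>\<lambda>\<^sub>k k\<^sup>1\<^sup>-\<^sup>d \<rightarrow> (\<Sum>i. g\<^sub>i) / \<Gamma>(d) = \<alpha>(1) / (\<beta>(1) \<Gamma>(d))\<close>, and both claims follow.
\<close>

text \<open>The two weights have ratio tending to 1. Passing to \<open>Suc k\<close> gives a weight
  that is positive also at \<open>k = 0\<close>, where \<open>real k powr e\<close> is 0.\<close>

lemma tendsto_mult_Suc_powr_iff:
  fixes f :: "nat \<Rightarrow> 'a :: real_normed_field"
  shows "(\<lambda>k. f k * of_real (real (Suc k) powr e)) \<longlonglongrightarrow> L \<longleftrightarrow>
         (\<lambda>k. f k * of_real (real k powr e)) \<longlonglongrightarrow> L"
proof
  assume "(\<lambda>k. f k * of_real (real (Suc k) powr e)) \<longlonglongrightarrow> L"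
  moreover have "(\<lambda>k. of_real ((real k / real (Suc k)) powr e) :: 'a) \<longlonglongrightarrow> of_real 1"
    by (intro tendsto_of_real) real_asymp
  ultimately have "(\<lambda>k. f k * of_real (real (Suc k) powr e) *
      of_real ((real k / real (Suc k)) powr e)) \<longlonglongrightarrow> L * of_real 1"
    by (rule tendsto_mult)
  also have "(\<lambda>k. f k * of_real (real (Suc k) powr e) * of_real ((real k / real (Suc k)) powr e)) =
      (\<lambda>k. f k * of_real (real k powr e))"
    by (intro ext) (simp add: powr_divide)
  finally show "(\<lambda>k. f k * of_real (real k powr e)) \<longlonglongrightarrow> L"
    by simp
next
  assume "(\<lambda>k. f k * of_real (real k powr e)) \<longlonglongrightarrow> L"
  moreover have "(\<lambda>k. of_real ((real (Suc k) / real k) powr e) :: 'a) \<longlonglongrightarrow> of_real 1"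
    by (intro tendsto_of_real) real_asymp
  ultimately have "(\<lambda>k. f k * of_real (real k powr e) *
      of_real ((real (Suc k) / real k) powr e)) \<longlonglongrightarrow> L * of_real 1"
    by (rule tendsto_mult)
  \<comment> \<open>Here the identity can fail at \<open>k = 0\<close>, where the left side
    vanishes; in the other direction it holds for every \<open>k\<close>.\<close>
  moreover have "eventually (\<lambda>k. f k * of_real (real k powr e) *
      of_real ((real (Suc k) / real k) powr e) = f k * of_real (real (Suc k) powr e)) sequentially"
    using eventually_gt_at_top[of 0] by eventually_elim (simp add: powr_divide)
  ultimately have "(\<lambda>k. f k * of_real (real (Suc k) powr e)) \<longlonglongrightarrow> L * of_real 1"
    by (rule Lim_transform_eventually)
  then show "(\<lambda>k. f k * of_real (real (Suc k) powr e)) \<longlonglongrightarrow> L"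
    by simp
qed

text \<open>The ratio of \<open>Suc k\<close> to \<open>Suc (k - i)\<close> lies between 1 and
  \<open>Suc i\<close>; the absolute value covers both signs of \<open>e\<close>. The factor is
  independent of \<open>k\<close>, as domination requires.\<close>

lemma powr_Suc_diff_le:
  assumes "i \<le> k"
  shows "real (Suc k) powr e \<le> real (Suc i) powr \<bar>e\<bar> * real (Suc (k - i)) powr e"
proof -
  define x where "x = real (Suc k) / real (Suc (k - i))"
  obtain m where k: "k = m + i"
    using assms le_Suc_ex by (metis add.commute)
  have x: "1 \<le> x" "x \<le> real (Suc i)"
    by (simp_all add: x_def k field_simps)
  have "real (Suc k) powr e = x powr e * real (Suc (k - i)) powr e"
    by (simp add: x_def powr_divide)
  also have "x powr e \<le> x powr \<bar>e\<bar>"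
    using x by (intro powr_mono) auto
  also have "\<dots> \<le> real (Suc i) powr \<bar>e\<bar>"
    using x by (intro powr_mono2) auto
  finally show ?thesis
    by (simp add: mult_right_mono)
qed

lemma convolution_powr_tendsto:
  fixes g c :: "nat \<Rightarrow> 'a :: {real_normed_field, banach}"
  assumes c: "(\<lambda>k. c k * of_real (real k powr e)) \<longlonglongrightarrow> L"
    and g: "summable (\<lambda>i. norm (g i) * real (Suc i) powr \<bar>e\<bar>)"
  shows "(\<lambda>k. (\<Sum>i\<le>k. g i * c (k - i)) * of_real (real k powr e)) \<longlonglongrightarrow> suminf g * L"
proof -
  define w where "w k = real (Suc k) powr e" for k
  \<comment> \<open>Extension by zero turns the finite convolution into a series over all
    \<open>i\<close>, the form needed for Tannery's theorem.\<close>
  define a where "a i k = (if i \<le> k then g i * c (k - i) * of_real (w k) else 0)" for i k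
  have cw: "(\<lambda>k. c k * of_real (w k)) \<longlonglongrightarrow> L"
    unfolding w_def tendsto_mult_Suc_powr_iff by (rule c)
  \<comment> \<open>Since \<open>w 0 = 1\<close>, the bound also controls \<open>c 0\<close>, which
    enters the convolution at \<open>i = k\<close>.\<close>
  then have "Bseq (\<lambda>k. c k * of_real (w k))"
    by (intro convergent_imp_Bseq convergentI)
  then obtain M where M: "M > 0" "norm (c k * of_real (w k)) \<le> M" for k
    by (auto simp: Bseq_def)
  have lim: "(\<lambda>k. a i k) \<longlonglongrightarrow> g i * L" for i
  \<comment> \<open>After a shift by the fixed \<open>i\<close> the condition
    \<open>i \<le> k\<close> always holds, and the weight changes only by a factor tending to
    1.\<close>
  proof (rule LIMSEQ_offset[where k = i])
    have "(\<lambda>k. of_real ((real (Suc (k + i)) / real (Suc k)) powr e) :: 'a) \<longlonglongrightarrow> of_real 1"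
      by (intro tendsto_of_real) real_asymp
    with cw have "(\<lambda>k. g i * (c k * of_real (w k) *
        of_real ((real (Suc (k + i)) / real (Suc k)) powr e))) \<longlonglongrightarrow> g i * (L * of_real 1)"
      by (intro tendsto_mult tendsto_const)
    also have "(\<lambda>k. g i * (c k * of_real (w k) *
        of_real ((real (Suc (k + i)) / real (Suc k)) powr e))) = (\<lambda>k. a i (k + i))"
      by (intro ext) (simp add: a_def w_def powr_divide)
    finally show "(\<lambda>k. a i (k + i)) \<longlonglongrightarrow> g i * L"
      by simp
  qed
  have bound: "norm (a i k) \<le> M * (norm (g i) * real (Suc i) powr \<bar>e\<bar>)" for i k
  proof (cases "i \<le> k")
    case True
    have "norm (a i k) = norm (g i) * norm (c (k - i)) * w k"
      using True by (simp add: a_def norm_mult w_def)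
    also have "\<dots> \<le> norm (g i) * norm (c (k - i)) * (real (Suc i) powr \<bar>e\<bar> * w (k - i))"
      unfolding w_def by (intro mult_left_mono powr_Suc_diff_le True) auto
    also have "\<dots> = norm (g i) * real (Suc i) powr \<bar>e\<bar> * norm (c (k - i) * of_real (w (k - i)))"
      by (simp add: norm_mult w_def)
    also have "\<dots> \<le> norm (g i) * real (Suc i) powr \<bar>e\<bar> * M"
      by (intro mult_left_mono M) auto
    finally show ?thesis
      by (simp add: mult_ac)
  qed (use M in \<open>auto simp: a_def\<close>)
  have "summable (\<lambda>i. M * (norm (g i) * real (Suc i) powr \<bar>e\<bar>))"
    using g by (rule summable_mult)
  moreover have "\<forall>\<^sub>F (i, k) in sequentially \<times>\<^sub>F sequentially.
      norm (a i k) \<le> M * (norm (g i) * real (Suc i) powr \<bar>e\<bar>)"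
    by (intro always_eventually) (simp only: bound split_paired_All prod.case simp_thms)
  ultimately have *: "(\<lambda>k. \<Sum>i. a i k) \<longlonglongrightarrow> (\<Sum>i. g i * L)"
    using tannerys_theorem[where a = a and b = "\<lambda>i. g i * L" and F = sequentially
        and M = "\<lambda>i. M * (norm (g i) * real (Suc i) powr \<bar>e\<bar>)"] lim
      trivial_limit_sequentially by blast
  have "summable g"
  proof (rule summable_comparison_test'[OF g])
    show "norm (g i) \<le> norm (g i) * real (Suc i) powr \<bar>e\<bar>" for i
      using ge_one_powr_ge_zero[of "real (Suc i)" "\<bar>e\<bar>"] by (simp add: mult_le_cancel_left1)
  qed
  then have "(\<Sum>i. g i * L) = suminf g * L"
    by (rule suminf_mult2[symmetric])
  moreover have "(\<Sum>i. a i k) = (\<Sum>i\<le>k. g i * c (k - i)) * of_real (w k)" for k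
  proof -
    have "(\<Sum>i. a i k) = (\<Sum>i\<le>k. a i k)"
      by (intro suminf_finite) (auto simp: a_def)
    then show ?thesis
      by (simp add: a_def sum_distrib_right)
  qed
  ultimately have "(\<lambda>k. (\<Sum>i\<le>k. g i * c (k - i)) * of_real (w k)) \<longlonglongrightarrow> suminf g * L"
    using * by simp
  then show ?thesis
    unfolding w_def tendsto_mult_Suc_powr_iff .
qed

text \<open>For \<open>r\<close> strictly between 1 and the radius of convergence, the series
  converges absolutely at \<open>r\<close>, and \<open>r ^ i\<close> eventually dominates every
  power of \<open>Suc i\<close>.\<close>

lemma summable_fps_nth_mult_powr:
  fixes F :: "'a :: {real_normed_field, banach} fps"
  assumes "fps_conv_radius F > 1"
  shows "summable (\<lambda>i. norm (fps_nth F i) * real (Suc i) powr e)"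
proof -
  obtain r where r: "1 < ereal r" "ereal r < fps_conv_radius F"
    using assms ereal_dense2 by blast
  then have r1: "r > 1"
    by simp
  have "summable (\<lambda>i. norm (fps_nth F i * of_real r ^ i))"
    using r r1 by (intro norm_summable_fps) simp
  then have s: "summable (\<lambda>i. norm (fps_nth F i) * r ^ i)"
    using r1 by (simp add: norm_mult norm_power)
  have "(\<lambda>i. real (Suc i) powr e / r ^ i) \<longlonglongrightarrow> 0"
    using r1 by real_asymp
  then have "eventually (\<lambda>i. real (Suc i) powr e / r ^ i < 1) sequentially"
    by (rule order_tendstoD) simp
  then have "eventually (\<lambda>i. norm (norm (fps_nth F i) * real (Suc i) powr e) \<le>
      norm (fps_nth F i) * r ^ i) sequentially"
  proof eventually_elim
    case (elim i)
    then have "real (Suc i) powr e \<le> r ^ i"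
      using r1 by (simp add: field_simps)
    then show ?case
      by (simp add: mult_left_mono)
  qed
  then show ?thesis
    using s by (rule summable_comparison_test_ev)
qed

lemma poly_nonzero_larger_disc:
  fixes p :: "complex poly"
  assumes nz: "\<And>z. cmod z \<le> 1 \<Longrightarrow> poly p z \<noteq> 0"
  obtains R where "R > 1" "\<And>z. cmod z < R \<Longrightarrow> poly p z \<noteq> 0"
proof
  \<comment> \<open>The element 2 keeps \<open>S\<close> nonempty when \<open>p\<close> has no
    roots; any number above 1 would do.\<close>
  define S where "S = insert 2 (cmod ` {z. poly p z = 0})"
  have "p \<noteq> 0"
    using nz[of 0] by auto
  then have S: "finite S" "S \<noteq> {}"
    by (auto simp: S_def poly_roots_finite)
  show "Min S > 1"
    unfolding Min_gr_iff[OF S] using nz by (auto simp: S_def not_le[symmetric])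
  show "poly p z \<noteq> 0" if "cmod z < Min S" for z
  proof
    assume "poly p z = 0"
    then have "Min S \<le> cmod z"
      using S by (intro Min_le) (auto simp: S_def)
    with that show False
      by simp
  qed
qed

lemma frac_int_series_sums:
  assumes "cmod z < 1"
  shows "(\<lambda>k. (of_real (- d) gchoose k) * (- 1) ^ k * z ^ k) sums frac_int_series d z"
proof -
  have "(\<lambda>k. (of_real (- d) gchoose k) * (- z) ^ k) sums frac_int_series d z"
    unfolding frac_int_series_def
    using gen_binomial_complex[of "- z" "of_real (- d)"] assms
    by (intro summable_sums) (auto intro: sums_summable)
  also have "(\<lambda>k. (of_real (- d) gchoose k) * (- z) ^ k) =
      (\<lambda>k. (of_real (- d) gchoose k) * (- 1) ^ k * z ^ k)"
    by (intro ext) (metis mult.assoc power_minus)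
  finally show ?thesis .
qed

text \<open>At the poles of \<open>Gamma\<close> the limit is \<open>inverse 0 = 0\<close>, the correct value of \<open>1/\<Gamma>\<close>.\<close>

lemma frac_int_coeff_tendsto:
  fixes d :: real
  shows "(\<lambda>k. (of_real (- d) gchoose k) * (- 1) ^ k * of_real (real k powr (1 - d)) :: complex)
           \<longlonglongrightarrow> of_real (inverse (Gamma d))"
proof -
  have "(\<lambda>n. (complex_of_real (- d) gchoose n) /
      ((- 1) ^ n / exp ((of_real (- d) + 1) * of_real (ln (real n)))))
      \<longlonglongrightarrow> inverse (Gamma (- of_real (- d)))"
    by (rule gbinomial_asymptotic)
  also have "inverse (Gamma (- complex_of_real (- d))) = of_real (inverse (Gamma d))"
    by (simp add: Gamma_complex_of_real)
  finally show ?thesis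
  proof (rule Lim_transform_eventually)
    \<comment> \<open>The index 0 is excluded because \<open>0 powr (1 - d)\<close> is 0, whereas
      the exponential never vanishes.\<close>
    show "\<forall>\<^sub>F n in sequentially. (complex_of_real (- d) gchoose n) /
        ((- 1) ^ n / exp ((of_real (- d) + 1) * of_real (ln (real n)))) =
        (of_real (- d) gchoose n) * (- 1) ^ n * of_real (real n powr (1 - d))"
      using eventually_gt_at_top[of 0]
    proof eventually_elim
      case (elim n)
      have "exp ((complex_of_real (- d) + 1) * of_real (ln (real n))) =
          of_real (exp ((1 - d) * ln (real n)))"
        by (simp flip: exp_of_real)
      also have "\<dots> = of_real (real n powr (1 - d))"
        using elim by (simp add: powr_def)
      finally show ?case
        by (cases "even n") simp_all
    qed
  qed
qed

text \<open>Uniqueness of power series expansions at 0 identifies \<open>lam\<close> with the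
  convolution of the coefficients of \<alpha>/\<beta> and of the binomial series.\<close>

lemma arma_coeff_tendsto:
  fixes \<alpha> \<beta> :: "complex poly"
  assumes nz: "\<And>z. cmod z \<le> 1 \<Longrightarrow> poly \<beta> z \<noteq> 0"
    and lam: "\<And>z. cmod z < 1 \<Longrightarrow>
      (\<lambda>k. lam k * z ^ k) sums (poly \<alpha> z / poly \<beta> z * frac_int_series d z)"
  shows "(\<lambda>k. lam k * of_real (real k powr (1 - d)))
           \<longlonglongrightarrow> poly \<alpha> 1 / poly \<beta> 1 * of_real (inverse (Gamma d))"
proof -
  obtain R where R: "R > 1" "\<And>z. cmod z < R \<Longrightarrow> poly \<beta> z \<noteq> 0"
    using poly_nonzero_larger_disc[OF nz] by metis
  define G where "G = fps_of_poly \<alpha> / fps_of_poly \<beta>"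
  define c :: "nat \<Rightarrow> complex" where "c k = (of_real (- d) gchoose k) * (- 1) ^ k" for k
  \<comment> \<open>The radii of the two polynomials are infinite, so the minimum is
    \<open>R\<close>.\<close>
  have "fps_conv_radius G \<ge> Min {ereal R, fps_conv_radius (fps_of_poly \<alpha>), fps_conv_radius (fps_of_poly \<beta>)}"
    unfolding G_def using R by (intro fps_conv_radius_divide') auto
  then have GR: "fps_conv_radius G \<ge> ereal R"
    by simp
  then have rad: "fps_conv_radius G > 1"
    using R(1) by (intro less_le_trans[OF _ GR]) simp
  have eval: "eval_fps G z = poly \<alpha> z / poly \<beta> z" if "cmod z < R" for z
    unfolding G_def using R that
    by (subst eval_fps_divide'[where r = "ereal R"]) auto
  have unit: "eventually (\<lambda>z. cmod z < 1) (nhds (0 :: complex))"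
    using eventually_nhds_in_open[of "ball 0 1" "0 :: complex"] by simp
  have lam_exp: "(\<lambda>z. poly \<alpha> z / poly \<beta> z * frac_int_series d z) has_fps_expansion Abs_fps lam"
    using unit by (intro has_fps_expansionI) (auto elim!: eventually_mono dest: lam)
  have "(\<lambda>z. eval_fps G z * frac_int_series d z) has_fps_expansion G * Abs_fps c"
  proof (intro has_fps_expansion_mult eval_fps_has_fps_expansion)
    show "fps_conv_radius G > 0"
      by (rule less_trans[OF _ rad]) simp
    show "frac_int_series d has_fps_expansion Abs_fps c"
      using unit by (intro has_fps_expansionI)
        (auto elim!: eventually_mono dest!: frac_int_series_sums simp: c_def)
  qed
  also have "?this \<longleftrightarrow> (\<lambda>z. poly \<alpha> z / poly \<beta> z * frac_int_series d z) has_fps_expansion G * Abs_fps c"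
  proof (rule has_fps_expansion_cong)
    show "\<forall>\<^sub>F z in nhds 0. eval_fps G z * frac_int_series d z =
        poly \<alpha> z / poly \<beta> z * frac_int_series d z"
      using unit by eventually_elim (use R in \<open>simp add: eval\<close>)
  qed simp
  finally have "Abs_fps lam = G * Abs_fps c"
    by (rule fps_expansion_unique_complex[OF lam_exp])
  then have "fps_nth (Abs_fps lam) k = fps_nth (G * Abs_fps c) k" for k
    by simp
  then have lam_eq: "lam k = (\<Sum>i\<le>k. fps_nth G i * c (k - i))" for k
    by (simp add: fps_mult_nth atLeast0AtMost)
  have "(\<lambda>k. (\<Sum>i\<le>k. fps_nth G i * c (k - i)) * of_real (real k powr (1 - d)))
      \<longlonglongrightarrow> suminf (fps_nth G) * of_real (inverse (Gamma d))"
    by (intro convolution_powr_tendsto summable_fps_nth_mult_powr rad)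
      (use frac_int_coeff_tendsto[of d] in \<open>simp add: c_def\<close>)
  also have "suminf (fps_nth G) = eval_fps G 1"
    by (simp add: eval_fps_def)
  \<comment> \<open>The point 1 lies inside the disc of radius \<open>R\<close>, so no boundary
    argument is needed.\<close>
  also have "\<dots> = poly \<alpha> 1 / poly \<beta> 1"
    using R by (intro eval) simp
  finally show ?thesis
    by (simp add: lam_eq)
qed

text \<open>The equivalence is restricted to a nonzero limit constant: at a pole of
  \<open>Gamma\<close> or a zero of \<alpha> at 1 the comparison sequence is identically 0, and
  equivalence would force \<open>lam\<close> to vanish eventually. The growth bound holds in all
  cases.\<close>

theorem theorem3:
  fixes d :: real
    and p q :: nat
    and a b :: "nat \<Rightarrow> complex"
    and \<alpha> \<beta> :: "complex poly"
    and lam :: "nat \<Rightarrow> complex"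
  assumes alpha: "\<alpha> = arma_poly p a" "degree \<alpha> = p"
    and beta: "\<beta> = arma_poly q b" "degree \<beta> = q"
    and no_common_roots: "\<nexists>z. poly \<alpha> z = 0 \<and> poly \<beta> z = 0"
    and beta_nonzero: "\<And>z. cmod z \<le> 1 \<Longrightarrow> poly \<beta> z \<noteq> 0"
    and lam: "\<And>z. cmod z < 1 \<Longrightarrow>
      (\<lambda>k. lam k * z ^ k) sums (poly \<alpha> z / poly \<beta> z * frac_int_series d z)"
  shows "(d \<notin> \<int>\<^sub>\<le>\<^sub>0 \<and> poly \<alpha> 1 \<noteq> 0 \<longrightarrow>
           lam \<sim>[at_top] (\<lambda>k. of_real (1 / (Gamma d * real k powr (1 - d))) * (poly \<alpha> 1 / poly \<beta> 1)))
         \<and> (\<lambda>k. cmod (lam k)) \<in> O(\<lambda>k. real k powr (d - 1))"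
proof
  define A where "A = poly \<alpha> 1 / poly \<beta> 1 * of_real (inverse (Gamma d))"
  have lim: "(\<lambda>k. lam k * of_real (real k powr (1 - d))) \<longlonglongrightarrow> A"
    unfolding A_def using beta_nonzero lam by (rule arma_coeff_tendsto)
  show "d \<notin> \<int>\<^sub>\<le>\<^sub>0 \<and> poly \<alpha> 1 \<noteq> 0 \<longrightarrow>
      lam \<sim>[at_top] (\<lambda>k. of_real (1 / (Gamma d * real k powr (1 - d))) * (poly \<alpha> 1 / poly \<beta> 1))"
  proof
    assume "d \<notin> \<int>\<^sub>\<le>\<^sub>0 \<and> poly \<alpha> 1 \<noteq> 0"
    then have "A \<noteq> 0"
      using beta_nonzero[of 1] by (auto simp: A_def Gamma_eq_zero_iff)
    then have "(\<lambda>k. lam k * of_real (real k powr (1 - d)) / A) \<longlonglongrightarrow> 1"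
      using tendsto_divide[OF lim tendsto_const[of A]] by simp
    \<comment> \<open>At \<open>k = 0\<close> both sides are 0 by the conventions for
      \<open>powr\<close> and division, so the identity holds for every \<open>k\<close>.\<close>
    also have "(\<lambda>k. lam k * of_real (real k powr (1 - d)) / A) =
        (\<lambda>k. lam k / (of_real (1 / (Gamma d * real k powr (1 - d))) * (poly \<alpha> 1 / poly \<beta> 1)))"
      by (intro ext) (simp add: A_def field_simps)
    finally show "lam \<sim>[at_top]
        (\<lambda>k. of_real (1 / (Gamma d * real k powr (1 - d))) * (poly \<alpha> 1 / poly \<beta> 1))"
      by (rule asymp_equivI')
  qed
  show "(\<lambda>k. cmod (lam k)) \<in> O(\<lambda>k. real k powr (d - 1))"
  \<comment> \<open>A finite limit of the quotient suffices, so \<open>A = 0\<close> needs no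
    separate case.\<close>
  proof (rule bigoI_tendsto)
    show "(\<lambda>k. cmod (lam k) / real k powr (d - 1)) \<longlonglongrightarrow> cmod A"
    proof (rule Lim_transform_eventually[OF tendsto_norm[OF lim]])
      show "\<forall>\<^sub>F k in sequentially. cmod (lam k * of_real (real k powr (1 - d))) =
          cmod (lam k) / real k powr (d - 1)"
        by (intro always_eventually allI) (simp add: norm_mult divide_inverse flip: powr_minus)
    qed
    show "\<forall>\<^sub>F k in sequentially. real k powr (d - 1) \<noteq> 0"
      using eventually_gt_at_top[of 0] by eventually_elim simp
  qed
qed

end
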